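(* Let $G\in\mathbb{R}^{n\times n}$ be an irreducible stochastic matrix with stationary distribution $\mu>0$. Let $\lambda>0$ and $j\in\{1,\dots,n\}$, and assume $\hat\mu=\frac{1}{1+\lambda}(\mu+\lambda \mathbf{e}_j)$. Assume also that $\lambda\ge\mu_i-\mu_j$ for all $i\ne j$, that is, $j\in\mathrm{argmax}_k\,\hat\mu_k$. Let $c^*=1/\|\mu./\hat\mu\|_\infty$, $\alpha^*=\mathbf{1}_n-c^*(\mu./\hat\mu)$ and $\Delta(\alpha^* )=\mathrm{Diag}(\alpha^*_1,\dots,\alpha^*_n)(I_n-G)$. Then $\Delta(\alpha^* )$ is an optimal solution of the target stationary distribution problem $$\min_{\Delta\in\mathcal D}\|\Delta\|,\qquad \mathcal D=\{\Delta\in\mathbb{R}^{n\times n}\ :\ \hat\mu^\top(G+\Delta)=\hat\mu^\top,\ \Delta\mathbf{1}_n=\mathbf{0}_n,\ G+\Delta\ge 0\},$$ both when $\|\cdot\|$ is the component-wise $\ell_1$ norm and when $\|\cdot\|$ is the matrix $\ell_1$ norm.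
   Context: All inequalities between vectors and matrices are entrywise. $\mathbf{0}_n,\mathbf{1}_n$ are the all-zeros and all-ones vectors in $\mathbb{R}^n$, $\mathbf{e}_j$ is the $j$th standard basis vector, $I_n$ is the identity matrix. A matrix $G\in\mathbb{R}^{n\times n}$ is stochastic if $G\ge 0$ and $G\mathbf{1}_n=\mathbf{1}_n$. It is irreducible if there is no partition of $\{1,\dots,n\}$ into two nonempty disjoint sets $\mathcal I,\mathcal J$ with $G_{i,j}=0$ for all $i\in\mathcal I$, $j\in\mathcal J$. The stationary distribution of an irreducible stochastic $G$ is the unique vector $\mu>0$ with $\mu^\top G=\mu^\top$ and $\mu^\top\mathbf{1}_n=1$. $\mu./\hat\mu$ denotes the entrywise quotient, with entries $\mu_i/\hat\mu_i$. The component-wise $\ell_1$ norm is $\|\Delta\|_1=\sum_{i,j}|\Delta_{i,j}|$; the matrix $\ell_1$ norm is the induced norm $\max_{z\ne 0}\|\Delta z\|_1/\|z\|_1$. *)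

theory Defs
  imports "HOL-Analysis.Analysis"
begin

(* Library conventions for real^'n and real^'n^'n: "0 \<le> A" is entrywise (also for matrices),
   (1 :: real^'n) is the all-ones vector, mat 1 is the identity matrix, axis j 1 is the j-th
   standard basis vector and infnorm is the l-infinity norm. The library's strict order "<" on
   vectors is not the entrywise one, so strict positivity is written out. *)

definition stochastic :: "real^'n^'n \<Rightarrow> bool" where
  "stochastic G \<longleftrightarrow> 0 \<le> G \<and> G *v 1 = 1"

definition irreducible_matrix :: "real^'n^'n \<Rightarrow> bool" where
  "irreducible_matrix G \<longleftrightarrow>
     \<not> (\<exists>I J. I \<noteq> {} \<and> J \<noteq> {} \<and> I \<inter> J = {} \<and> I \<union> J = UNIV \<and>
            (\<forall>i\<in>I. \<forall>j\<in>J. G $ i $ j = 0))"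

definition stationary_distribution :: "real^'n^'n \<Rightarrow> real^'n \<Rightarrow> bool" where
  "stationary_distribution G \<mu> \<longleftrightarrow>
     (\<forall>i. 0 < \<mu> $ i) \<and> \<mu> v* G = \<mu> \<and> (\<Sum>i\<in>UNIV. \<mu> $ i) = 1"

definition entrywise_div :: "real^'n \<Rightarrow> real^'n \<Rightarrow> real^'n" where
  "entrywise_div x y = (\<chi> i. x $ i / y $ i)"

definition Diag :: "real^'n \<Rightarrow> real^'n^'n" where
  "Diag a = (\<chi> i j. if i = j then a $ i else 0)"

definition l1_norm :: "real^'n \<Rightarrow> real" where
  "l1_norm x = (\<Sum>i\<in>UNIV. \<bar>x $ i\<bar>)"

definition componentwise_l1_norm :: "real^'n^'n \<Rightarrow> real" where
  "componentwise_l1_norm A = (\<Sum>i\<in>UNIV. \<Sum>j\<in>UNIV. \<bar>A $ i $ j\<bar>)"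

(* The induced norm is a maximum in the mathematical definition; the library's Max is only
   meaningful on finite sets, so the supremum is used. It is attained, by matrix_l1_norm_attained. *)
definition matrix_l1_norm :: "real^'n^'n \<Rightarrow> real" where
  "matrix_l1_norm A = (SUP z\<in>{z. z \<noteq> 0}. l1_norm (A *v z) / l1_norm z)"

definition target_feasible :: "real^'n^'n \<Rightarrow> real^'n \<Rightarrow> (real^'n^'n) set" where
  "target_feasible G \<mu>h = {\<Delta>. \<mu>h v* (G + \<Delta>) = \<mu>h \<and> \<Delta> *v 1 = 0 \<and> 0 \<le> G + \<Delta>}"

definition optimal_solution ::
  "(real^'n^'n \<Rightarrow> real) \<Rightarrow> real^'n^'n \<Rightarrow> real^'n \<Rightarrow> real^'n^'n \<Rightarrow> bool" where
  "optimal_solution N G \<mu>h \<Delta> \<longleftrightarrow> is_arg_min N (\<lambda>X. X \<in> target_feasible G \<mu>h) \<Delta>"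

lemma l1_norm_pos:
  assumes "z \<noteq> 0"
  shows "0 < l1_norm z"
proof -
  obtain i where "z $ i \<noteq> 0" using assms by (auto simp: vec_eq_iff)
  then have "0 < \<bar>z $ i\<bar>" by simp
  also have "\<dots> \<le> l1_norm z"
    unfolding l1_norm_def by (rule member_le_sum) auto
  finally show ?thesis .
qed

lemma matrix_l1_norm_attained:
  fixes A :: "real^'n^'n"
  shows "\<exists>z. z \<noteq> 0 \<and> l1_norm (A *v z) / l1_norm z = matrix_l1_norm A
           \<and> (\<forall>w. w \<noteq> 0 \<longrightarrow> l1_norm (A *v w) / l1_norm w \<le> l1_norm (A *v z) / l1_norm z)"
proof -
  define s where "s k = (\<Sum>i\<in>UNIV. \<bar>A $ i $ k\<bar>)" for k
  have "Max (range s) \<in> range s" by (rule Max_in) auto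
  then obtain k where k0: "Max (range s) = s k" by (rule imageE)
  have k: "s i \<le> s k" for i using Max_ge[of "range s" "s i"] by (simp add: k0)
  have ub: "l1_norm (A *v w) / l1_norm w \<le> s k" if "w \<noteq> 0" for w
  proof -
    have "l1_norm (A *v w) \<le> (\<Sum>i\<in>UNIV. \<Sum>j\<in>UNIV. \<bar>A $ i $ j\<bar> * \<bar>w $ j\<bar>)"
      unfolding l1_norm_def matrix_vector_mult_def vec_lambda_beta
      by (intro sum_mono order_trans[OF sum_abs]) (simp add: abs_mult)
    also have "\<dots> = (\<Sum>j\<in>UNIV. s j * \<bar>w $ j\<bar>)"
      unfolding s_def by (subst sum.swap) (simp add: sum_distrib_right)
    also have "\<dots> \<le> (\<Sum>j\<in>UNIV. s k * \<bar>w $ j\<bar>)"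
      by (intro sum_mono mult_right_mono k) simp
    also have "\<dots> = s k * l1_norm w" by (simp add: l1_norm_def sum_distrib_left)
    finally show ?thesis using l1_norm_pos[OF that] by (simp add: field_simps)
  qed
  let ?z = "axis k 1 :: real^'n"
  have z: "?z \<noteq> 0" by (simp add: axis_eq_0_iff)
  have "l1_norm (A *v ?z) = s k"
    by (simp add: l1_norm_def s_def matrix_vector_mul_component inner_axis)
  moreover have "l1_norm ?z = (\<Sum>i\<in>UNIV. if i = k then 1 else 0)"
    unfolding l1_norm_def by (rule sum.cong) (auto simp: axis_def)
  ultimately have zv: "l1_norm (A *v ?z) / l1_norm ?z = s k" by simp
  have "matrix_l1_norm A = s k"
    unfolding matrix_l1_norm_def
    by (rule cSup_eq_maximum) (use zv z ub in \<open>auto simp: image_iff intro!: exI[of _ ?z]\<close>)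
  then show ?thesis using z zv ub by (intro exI[of _ ?z]) metis
qed

end

theory Submission
  imports Defs
begin

text \<open>
  Write \<open>\<nu>\<close> for the target distribution \<open>\<mu>h\<close>. Every feasible \<open>X\<close> has the same product
  \<open>\<nu> v* X = \<nu> - \<nu> v* G\<close>, and since no entry of \<open>\<nu>\<close> exceeds \<open>\<nu> $ j\<close>, the \<open>k\<close>-th entry of this
  vector is in absolute value at most \<open>\<nu> $ j\<close> times the absolute sum of column \<open>k\<close> of \<open>X\<close>. A feasible matrix
  whose only nonzero row is row \<open>j\<close> turns this bound into an equality in every column.
  Hence its absolute column sums are minimal all at once
  (\<open>single_row_feasible_minimizes_column_sums\<close>), and both norms are monotone functions of the
  absolute column sums: the component-wise norm is their sum and the induced norm their maximum.

  It remains to see that \<open>Diag \<alpha> ** (mat 1 - G)\<close> is such a matrix. Feasibility holds for every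
  positive target: \<open>\<nu> v* Diag \<alpha>\<close> differs from \<open>\<nu>\<close> by a multiple of \<open>\<mu>\<close>, which \<open>mat 1 - G\<close>
  annihilates, and the choice of \<open>c\<close> is what keeps \<open>\<alpha>\<close> between 0 and 1 (\<open>diagonal_scaling_feasible\<close>). For a target obtained
  by moving \<open>\<mu>\<close> towards \<open>axis j 1\<close>, the quotient \<open>\<mu> $ i / \<nu> $ i\<close> equals \<open>1 + lam\<close> for each
  \<open>i \<noteq> j\<close>, and is at most that for \<open>i = j\<close>. So the maximum is attained at every index other than
  \<open>j\<close>, where \<open>\<alpha>\<close> therefore vanishes, and row \<open>j\<close> alone survives.
\<close>

text \<open>The absolute sum of a column is the ratio in the induced norm at the corresponding basis vector.\<close>

lemma column_sum_le_matrix_l1_norm: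
  fixes A :: "real^'n^'n"
  shows "(\<Sum>i\<in>UNIV. \<bar>A $ i $ k\<bar>) \<le> matrix_l1_norm A"
proof -
  let ?z = "axis k 1 :: real^'n"
  have "?z \<noteq> 0" by (simp add: axis_eq_0_iff)
  then have "l1_norm (A *v ?z) / l1_norm ?z \<le> matrix_l1_norm A"
    using matrix_l1_norm_attained[of A] by metis
  moreover have "l1_norm (A *v ?z) = (\<Sum>i\<in>UNIV. \<bar>A $ i $ k\<bar>)"
    by (simp add: l1_norm_def matrix_vector_mul_component inner_axis)
  moreover have "l1_norm ?z = (\<Sum>i\<in>UNIV. if i = k then 1 else 0)"
    unfolding l1_norm_def by (rule sum.cong) (auto simp: axis_def)
  ultimately show ?thesis by simp
qed

lemma matrix_l1_norm_le:
  fixes A :: "real^'n^'n"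
  assumes columns: "\<And>k. (\<Sum>i\<in>UNIV. \<bar>A $ i $ k\<bar>) \<le> s"
  shows "matrix_l1_norm A \<le> s"
proof -
  obtain z where "z \<noteq> 0" and z: "l1_norm (A *v z) / l1_norm z = matrix_l1_norm A"
    using matrix_l1_norm_attained[of A] by blast
  have "l1_norm (A *v z) \<le> (\<Sum>i\<in>UNIV. \<Sum>k\<in>UNIV. \<bar>A $ i $ k\<bar> * \<bar>z $ k\<bar>)"
    unfolding l1_norm_def matrix_vector_mult_def vec_lambda_beta
    by (intro sum_mono order_trans[OF sum_abs]) (simp add: abs_mult)
  also have "\<dots> = (\<Sum>k\<in>UNIV. (\<Sum>i\<in>UNIV. \<bar>A $ i $ k\<bar>) * \<bar>z $ k\<bar>)"
    by (subst sum.swap) (simp add: sum_distrib_right)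
  also have "\<dots> \<le> (\<Sum>k\<in>UNIV. s * \<bar>z $ k\<bar>)"
    by (intro sum_mono mult_right_mono columns) simp
  also have "\<dots> = s * l1_norm z" by (simp add: l1_norm_def sum_distrib_left)
  finally show ?thesis
    using l1_norm_pos[OF \<open>z \<noteq> 0\<close>] z by (simp add: field_simps)
qed

lemma matrix_l1_norm_mono_column_sums:
  fixes A B :: "real^'n^'n"
  assumes "\<And>k. (\<Sum>i\<in>UNIV. \<bar>A $ i $ k\<bar>) \<le> (\<Sum>i\<in>UNIV. \<bar>B $ i $ k\<bar>)"
  shows "matrix_l1_norm A \<le> matrix_l1_norm B"
  by (rule matrix_l1_norm_le) (rule order_trans[OF assms column_sum_le_matrix_l1_norm])

lemma componentwise_l1_norm_mono_column_sums:
  fixes A B :: "real^'n^'n"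
  assumes "\<And>k. (\<Sum>i\<in>UNIV. \<bar>A $ i $ k\<bar>) \<le> (\<Sum>i\<in>UNIV. \<bar>B $ i $ k\<bar>)"
  shows "componentwise_l1_norm A \<le> componentwise_l1_norm B"
  unfolding componentwise_l1_norm_def
  by (subst (1 2) sum.swap) (rule sum_mono, rule assms)

text \<open>
  Both matrices have the same product with \<open>\<nu>\<close>. Changing that product through column \<open>k\<close> is
  cheapest in the row of largest weight, and \<open>D\<close> uses no other row.
\<close>

lemma single_row_feasible_minimizes_column_sums:
  fixes G D X :: "real^'n^'n" and \<nu> :: "real^'n"
  assumes nonneg: "\<And>i. 0 \<le> \<nu> $ i" and largest: "\<And>i. \<nu> $ i \<le> \<nu> $ j" and pos: "0 < \<nu> $ j"
    and D: "D \<in> target_feasible G \<nu>" and X: "X \<in> target_feasible G \<nu>"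
    and row: "\<And>i k. i \<noteq> j \<Longrightarrow> D $ i $ k = 0"
  shows "(\<Sum>i\<in>UNIV. \<bar>D $ i $ k\<bar>) \<le> (\<Sum>i\<in>UNIV. \<bar>X $ i $ k\<bar>)"
proof -
  have "\<nu> v* (G + D) = \<nu> v* (G + X)"
    using D X by (simp add: target_feasible_def)
  then have same: "(\<nu> v* D) $ k = (\<nu> v* X) $ k"
    by (simp add: vector_matrix_mult_add_rdistrib)
  have "\<nu> $ j * (\<Sum>i\<in>UNIV. \<bar>D $ i $ k\<bar>) = \<nu> $ j * \<bar>D $ j $ k\<bar>"
    using row by (subst sum.remove[of _ j]) auto
  also have "\<dots> = \<bar>(\<nu> v* D) $ k\<bar>"
    unfolding vector_matrix_mult_def
    using row pos by (subst sum.remove[of _ j]) (auto simp: abs_mult)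
  also have "\<dots> = \<bar>(\<nu> v* X) $ k\<bar>"
    by (simp add: same)
  also have "\<dots> \<le> (\<Sum>i\<in>UNIV. \<nu> $ i * \<bar>X $ i $ k\<bar>)"
    unfolding vector_matrix_mult_def vec_lambda_beta
    by (rule order_trans[OF sum_abs]) (simp add: abs_mult nonneg mult.commute)
  also have "\<dots> \<le> (\<Sum>i\<in>UNIV. \<nu> $ j * \<bar>X $ i $ k\<bar>)"
    by (intro sum_mono mult_right_mono largest) simp
  also have "\<dots> = \<nu> $ j * (\<Sum>i\<in>UNIV. \<bar>X $ i $ k\<bar>)"
    by (simp add: sum_distrib_left)
  finally show ?thesis using pos by simp
qed

lemma Diag_mult_component:
  fixes A :: "real^'n^'n"
  shows "(Diag a ** A) $ i $ k = a $ i * A $ i $ k"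
proof -
  have "(Diag a ** A) $ i $ k = (\<Sum>l\<in>UNIV. if i = l then a $ i * A $ l $ k else 0)"
    unfolding matrix_matrix_mult_def Diag_def by (simp add: if_distrib if_distribR cong: if_cong)
  then show ?thesis by simp
qed

lemma vector_mult_Diag:
  fixes x a :: "real^'n"
  shows "x v* Diag a = (\<chi> i. x $ i * a $ i)"
proof -
  have "(x v* Diag a) $ i = (\<Sum>l\<in>UNIV. if l = i then x $ l * a $ l else 0)" for i
    unfolding vector_matrix_mult_def vec_lambda_beta Diag_def
    by (rule sum.cong) auto
  then show ?thesis by (simp add: vec_eq_iff)
qed

text \<open>
  The weights satisfy \<open>\<nu> v* Diag \<alpha> = \<nu> - c *\<^sub>R \<mu>\<close>, and \<open>\<mu>\<close> is annihilated by \<open>mat 1 - G\<close>, so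
  the perturbed matrix fixes \<open>\<nu>\<close> for every \<open>c\<close>. Row \<open>i\<close> of that matrix mixes row \<open>i\<close> of \<open>G\<close>
  with row \<open>i\<close> of the identity in proportion \<open>1 - \<alpha> $ i\<close> to \<open>\<alpha> $ i\<close>; this is nonnegative because dividing
  by the largest quotient puts \<open>\<alpha>\<close> between 0 and 1.
\<close>

lemma diagonal_scaling_feasible:
  fixes G :: "real^'n^'n" and \<mu> \<nu> \<alpha> :: "real^'n"
  assumes G: "stochastic G" and stationary: "\<mu> v* G = \<mu>"
    and \<mu>: "\<And>i. 0 \<le> \<mu> $ i" and \<nu>: "\<And>i. 0 < \<nu> $ i"
    and c: "c = 1 / infnorm (entrywise_div \<mu> \<nu>)"
    and \<alpha>: "\<alpha> = 1 - c *\<^sub>R entrywise_div \<mu> \<nu>"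
  shows "Diag \<alpha> ** (mat 1 - G) \<in> target_feasible G \<nu>"
proof -
  let ?D = "Diag \<alpha> ** (mat 1 - G)"
  have G0: "0 \<le> G $ i $ k" for i k
    using G by (simp add: stochastic_def less_eq_vec_def)
  have \<alpha>_comp: "\<alpha> $ i = 1 - c * (\<mu> $ i / \<nu> $ i)" for i
    by (simp add: \<alpha> entrywise_div_def)
  have quotient_nonneg: "0 \<le> \<mu> $ i / \<nu> $ i" for i
    using \<mu>[of i] \<nu>[of i] by simp
  have quotient_le: "\<mu> $ i / \<nu> $ i \<le> infnorm (entrywise_div \<mu> \<nu>)" for i
    using order_trans[OF abs_ge_self component_le_infnorm_cart[of "entrywise_div \<mu> \<nu>" i]]
    by (simp add: entrywise_div_def)
  have norm_nonneg: "0 \<le> infnorm (entrywise_div \<mu> \<nu>)"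
    by (rule infnorm_pos_le)
  have c_quotient: "c * (\<mu> $ i / \<nu> $ i) = (\<mu> $ i / \<nu> $ i) / infnorm (entrywise_div \<mu> \<nu>)" for i
    by (simp add: c)
  have \<alpha>_le: "\<alpha> $ i \<le> 1" for i
    unfolding \<alpha>_comp c_quotient
    using divide_nonneg_nonneg[OF quotient_nonneg[of i] norm_nonneg] by linarith
  have \<alpha>_ge: "0 \<le> \<alpha> $ i" for i
    unfolding \<alpha>_comp c_quotient
    using divide_le_eq_1[of "\<mu> $ i / \<nu> $ i" "infnorm (entrywise_div \<mu> \<nu>)"]
      quotient_le[of i] norm_nonneg by linarith
  have weights: "\<nu> v* Diag \<alpha> = \<nu> - c *\<^sub>R \<mu>"
    unfolding vector_mult_Diag vec_eq_iff using \<nu>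
    by (auto simp: \<alpha>_comp right_diff_distrib less_imp_neq[symmetric])
  have "\<nu> v* ?D = (\<nu> - c *\<^sub>R \<mu>) v* (mat 1 - G)"
    by (simp add: weights flip: vector_matrix_mul_assoc)
  also have "\<dots> = \<nu> v* (mat 1 - G) - c *\<^sub>R (\<mu> v* (mat 1 - G))"
    by (simp add: vector_matrix_mult_diff_distrib scaleR_vector_matrix_assoc)
  also have "\<dots> = \<nu> - \<nu> v* G"
    by (simp add: vector_matrix_mult_diff_rdistrib stationary)
  finally have "\<nu> v* (G + ?D) = \<nu>"
    by (simp add: vector_matrix_mult_add_rdistrib)
  moreover have "?D *v 1 = 0"
    using G by (simp add: stochastic_def matrix_vector_mult_diff_rdistrib
        flip: matrix_vector_mul_assoc)
  moreover have "0 \<le> (G + ?D) $ i $ k" for i k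
  proof -
    have "(G + ?D) $ i $ k = (1 - \<alpha> $ i) * G $ i $ k + \<alpha> $ i * mat 1 $ i $ k"
      by (simp add: Diag_mult_component algebra_simps)
    moreover have "0 \<le> (1 - \<alpha> $ i) * G $ i $ k"
      using \<alpha>_le[of i] G0[of i k] by simp
    moreover have "0 \<le> \<alpha> $ i * mat 1 $ i $ k"
      using \<alpha>_ge[of i] by (simp add: mat_def)
    ultimately show ?thesis by linarith
  qed
  ultimately show ?thesis
    by (simp add: target_feasible_def less_eq_vec_def)
qed

theorem theorem2p8:
  fixes G :: "real^'n^'n" and \<mu> \<mu>h \<alpha> :: "real^'n" and lam c :: real and j :: 'n
    and \<Delta> :: "real^'n^'n"
  assumes "stochastic G" and "irreducible_matrix G"
    and "stationary_distribution G \<mu>"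
    and "lam > 0"
    and "\<mu>h = (1 / (1 + lam)) *\<^sub>R (\<mu> + lam *\<^sub>R axis j 1)"
    and "\<And>i. i \<noteq> j \<Longrightarrow> lam \<ge> \<mu> $ i - \<mu> $ j"
    and "c = 1 / infnorm (entrywise_div \<mu> \<mu>h)"
    and "\<alpha> = 1 - c *\<^sub>R entrywise_div \<mu> \<mu>h"
    and "\<Delta> = Diag \<alpha> ** (mat 1 - G)"
  shows "optimal_solution componentwise_l1_norm G \<mu>h \<Delta>
       \<and> optimal_solution matrix_l1_norm G \<mu>h \<Delta>"
proof -
  have \<mu>: "0 < \<mu> $ i" for i
    using assms(3) by (simp add: stationary_distribution_def)
  have \<mu>h_j: "\<mu>h $ j = (\<mu> $ j + lam) / (1 + lam)"
    by (simp add: assms(5))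
  have \<mu>h_other: "\<mu>h $ i = \<mu> $ i / (1 + lam)" if "i \<noteq> j" for i
    using that by (simp add: assms(5) axis_def)
  have \<mu>h: "0 < \<mu>h $ i" for i
    using \<mu>[of i] assms(4) by (cases "i = j") (auto simp: \<mu>h_j \<mu>h_other)
  have largest: "\<mu>h $ i \<le> \<mu>h $ j" for i
    using assms(4) assms(6)[of i]
    by (cases "i = j") (auto simp: \<mu>h_j \<mu>h_other intro!: divide_right_mono)

  have feasible: "\<Delta> \<in> target_feasible G \<mu>h"
    unfolding assms(9)
    using assms(1,3) \<mu> \<mu>h
    by (intro diagonal_scaling_feasible[OF _ _ _ _ assms(7,8)])
      (auto simp: stationary_distribution_def intro: less_imp_le)

  have row: "\<Delta> $ i $ k = 0" if "i \<noteq> j" for i k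
  proof -
    have quotient: "entrywise_div \<mu> \<mu>h $ l = 1 + lam" if "l \<noteq> j" for l
      using \<mu>[of l] assms(4) by (simp add: entrywise_div_def \<mu>h_other[OF that])
    have "\<mu> $ j / \<mu>h $ j \<le> 1 + lam"
      using \<mu>[of j] assms(4) by (simp add: \<mu>h_j divide_le_eq mult.commute)
    then have "\<bar>entrywise_div \<mu> \<mu>h $ l\<bar> \<le> 1 + lam" for l
      using quotient[of l] \<mu>[of j] \<mu>h[of j] assms(4)
      by (cases "l = j") (auto simp: entrywise_div_def)
    then have "infnorm (entrywise_div \<mu> \<mu>h) \<le> 1 + lam"
      unfolding infnorm_cart by (intro cSup_least) auto
    moreover have "1 + lam \<le> infnorm (entrywise_div \<mu> \<mu>h)"
      using component_le_infnorm_cart[of "entrywise_div \<mu> \<mu>h" i] quotient[OF that] assms(4)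
      by simp
    ultimately have "\<alpha> $ i = 0"
      using quotient[OF that] assms(4) by (simp add: assms(7,8))
    then show ?thesis by (simp add: assms(9) Diag_mult_component)
  qed

  have columns: "(\<Sum>i\<in>UNIV. \<bar>\<Delta> $ i $ k\<bar>) \<le> (\<Sum>i\<in>UNIV. \<bar>X $ i $ k\<bar>)"
    if "X \<in> target_feasible G \<mu>h" for X k
    using single_row_feasible_minimizes_column_sums[OF less_imp_le[OF \<mu>h] largest \<mu>h feasible that row] .
  show ?thesis
    unfolding optimal_solution_def is_arg_min_linorder
    using feasible columns
    by (auto intro: componentwise_l1_norm_mono_column_sums matrix_l1_norm_mono_column_sums)
qed

end
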